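(* Let $\zeta(3)=\sum_{n=1}^{\infty} n^{-3}$. Then $$2\zeta(3)=b^{(1)}_0+\frac{a^{(1)}_1\vert}{\vert b^{(1)}_1}+\frac{a^{(1)}_2\vert}{\vert b^{(1)}_2}+\cdots+\frac{a^{(1)}_\nu\vert}{\vert b^{(1)}_\nu}+\cdots$$ and $$2\zeta(3)=b^{(2)}_0+\frac{a^{(2)}_1\vert}{\vert b^{(2)}_1}+\frac{a^{(2)}_2\vert}{\vert b^{(2)}_2}+\cdots+\frac{a^{(2)}_\nu\vert}{\vert b^{(2)}_\nu}+\cdots,$$ where $b^{(1)}_0=3$, $a^{(1)}_1=-81$, $a^{(1)}_\nu=-(\nu-1)^3\nu^3(4\nu^2-4\nu-3)^3$ for integers $\nu\ge 2$, and $b^{(1)}_\nu=4(68\nu^6-45\nu^4+12\nu^2-1)$ for integers $\nu\ge1$; and $b^{(2)}_0=2$, $a^{(2)}_1=42$, $a^{(2)}_\nu=-(\nu-1)^3\nu^3(4\nu^2-4\nu-3)\big((\nu+1)^3-\nu^3\big)\big((\nu-1)^3-(\nu-2)^3\big)$ for integers $\nu\ge2$, and $b^{(2)}_\nu=2(102\nu^6-68\nu^4+21\nu^2-3)$ for integers $\nu\ge1$.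
   Context: For sequences $(b_\nu)_{\nu\ge0}$ and $(a_\nu)_{\nu\ge1}$, the continued fraction $b_0+\frac{a_1\vert}{\vert b_1}+\frac{a_2\vert}{\vert b_2}+\cdots$ denotes $b_0+\cfrac{a_1}{b_1+\cfrac{a_2}{b_2+\cdots}}$, i.e. the limit as $\nu\to\infty$ of the convergents $P_\nu/Q_\nu$, where $P_\nu,Q_\nu$ satisfy $x_{\nu+1}=b_{\nu+1}x_\nu+a_{\nu+1}x_{\nu-1}$ for $\nu\ge0$ with $P_{-1}=1$, $Q_{-1}=0$, $P_0=b_0$, $Q_0=1$. The claim asserts that these convergents (well defined, i.e. with nonzero denominators) converge to $2\zeta(3)$. *)

theory Defs
  imports "HOL-Analysis.Analysis"
begin

definition zeta3 :: real where
  "zeta3 = (\<Sum>n. 1 / real (Suc n) ^ 3)"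

lemma zeta3_sums: "(\<lambda>n. 1 / real (Suc n) ^ 3) sums zeta3"
proof -
  have "summable (\<lambda>n. inverse (real n ^ 3))"
    by (rule inverse_power_summable) simp
  then have "summable (\<lambda>n. inverse (real (Suc n) ^ 3))"
    by (subst summable_Suc_iff)
  then show ?thesis
    unfolding zeta3_def by (simp add: field_simps summable_sums)
qed

text \<open>
  The solution \<open>x\<close> of \<open>x\<^bsub>\<nu>+1\<^esub> = b\<^bsub>\<nu>+1\<^esub> x\<^bsub>\<nu>\<^esub> + a\<^bsub>\<nu>+1\<^esub> x\<^bsub>\<nu>-1\<^esub>\<close> (\<open>\<nu> \<ge> 0\<close>) with initial
  values \<open>x\<^bsub>-1\<^esub> = u\<close> and \<open>x\<^bsub>0\<^esub> = v\<close>, restricted to indices \<open>\<ge> 0\<close>. The value \<open>a 0\<close> is never used.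
\<close>
fun cf_rec :: "(nat \<Rightarrow> real) \<Rightarrow> (nat \<Rightarrow> real) \<Rightarrow> real \<Rightarrow> real \<Rightarrow> nat \<Rightarrow> real" where
  "cf_rec b a u v 0 = v"
| "cf_rec b a u v (Suc 0) = b 1 * v + a 1 * u"
| "cf_rec b a u v (Suc (Suc n)) =
     b (Suc (Suc n)) * cf_rec b a u v (Suc n) + a (Suc (Suc n)) * cf_rec b a u v n"

definition cf_num :: "(nat \<Rightarrow> real) \<Rightarrow> (nat \<Rightarrow> real) \<Rightarrow> nat \<Rightarrow> real" where
  "cf_num b a = cf_rec b a 1 (b 0)"

definition cf_den :: "(nat \<Rightarrow> real) \<Rightarrow> (nat \<Rightarrow> real) \<Rightarrow> nat \<Rightarrow> real" where
  "cf_den b a = cf_rec b a 0 1"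

definition has_cf_value :: "(nat \<Rightarrow> real) \<Rightarrow> (nat \<Rightarrow> real) \<Rightarrow> real \<Rightarrow> bool" where
  "has_cf_value b a L \<longleftrightarrow>
     (\<forall>\<nu>. cf_den b a \<nu> \<noteq> 0) \<and> (\<lambda>\<nu>. cf_num b a \<nu> / cf_den b a \<nu>) \<longlonglongrightarrow> L"

definition b1 :: "nat \<Rightarrow> real" where
  "b1 \<nu> = (if \<nu> = 0 then 3
           else 4 * (68 * real \<nu> ^ 6 - 45 * real \<nu> ^ 4 + 12 * real \<nu> ^ 2 - 1))"

definition a1 :: "nat \<Rightarrow> real" where
  "a1 \<nu> = (if \<nu> = 1 then -81
           else - ((real \<nu> - 1) ^ 3 * real \<nu> ^ 3 * (4 * real \<nu> ^ 2 - 4 * real \<nu> - 3) ^ 3))"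

definition b2 :: "nat \<Rightarrow> real" where
  "b2 \<nu> = (if \<nu> = 0 then 2
           else 2 * (102 * real \<nu> ^ 6 - 68 * real \<nu> ^ 4 + 21 * real \<nu> ^ 2 - 3))"

definition a2 :: "nat \<Rightarrow> real" where
  "a2 \<nu> = (if \<nu> = 1 then 42
           else - ((real \<nu> - 1) ^ 3 * real \<nu> ^ 3 * (4 * real \<nu> ^ 2 - 4 * real \<nu> - 3)
                   * ((real \<nu> + 1) ^ 3 - real \<nu> ^ 3)
                   * ((real \<nu> - 1) ^ 3 - (real \<nu> - 2) ^ 3)))"

end

theory Submission
  imports Defs "HOL-Real_Asymp.Real_Asymp"
begin

text \<open>
  Both continued fractions come from Apery's recurrence
  \<open>(n+1)\<^sup>3 U\<^bsub>n+1\<^esub> = (34n\<^sup>3 + 51n\<^sup>2 + 27n + 5) U\<^bsub>n\<^esub> - n\<^sup>3 U\<^bsub>n-1\<^esub>\<close>: for every solution \<open>U\<close>, the differences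
  \<open>U\<^bsub>n+1\<^esub> - U\<^bsub>n\<^esub>\<close> (first fraction) and the sums \<open>U\<^bsub>n+1\<^esub> + U\<^bsub>n\<^esub>\<close> (second fraction), multiplied by suitable
  products, solve the recurrence of the convergents. The denominators arise from the Apery numbers,
  which grow at least like \<open>5\<^sup>n\<close>. The errors \<open>2\<zeta>(3) Q\<^bsub>n\<^esub> - P\<^bsub>n\<^esub>\<close> arise from Ball's very-well-poised series
  \<open>S\<^bsub>n\<^esub> = \<Sum>\<^bsub>t\<ge>1\<^esub> n!\<^sup>2 (2t+n) (t-1)\<cdots>(t-n) (t+n+1)\<cdots>(t+2n) / (t(t+1)\<cdots>(t+n))\<^sup>4\<close>, which is bounded, has
  \<open>S\<^bsub>0\<^esub> = 2\<zeta>(3)\<close> and \<open>S\<^bsub>1\<^esub> = 10\<zeta>(3) - 12\<close>, and solves Apery's recurrence by creative telescoping.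
\<close>

section \<open>Apery's recurrence as a linear condition on real sequences\<close>

definition apery_coeff :: "nat \<Rightarrow> real" where
  "apery_coeff n = 34 * real n ^ 3 + 51 * real n ^ 2 + 27 * real n + 5"

text \<open>The recurrence is imposed from index 1 on. Its instance at index 0 would force
  \<open>U 1 = 5 * U 0\<close>, which \<open>ball_sum\<close> violates: \<open>ball_sum 1\<close>
  equals \<open>5 * ball_sum 0 - 12\<close>.\<close>

definition apery_solution :: "(nat \<Rightarrow> real) \<Rightarrow> bool" where
  "apery_solution U \<longleftrightarrow>
     (\<forall>n. real (n + 2) ^ 3 * U (n + 2) = apery_coeff (n + 1) * U (n + 1) - real (n + 1) ^ 3 * U n)"

lemma apery_solution_mult_diff:
  assumes "apery_solution U" "apery_solution V"
  shows "apery_solution (\<lambda>n. c * U n - V n)"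
  unfolding apery_solution_def
proof
  fix n
  have "real (n + 2) ^ 3 * (c * U (n + 2) - V (n + 2))
      = c * (real (n + 2) ^ 3 * U (n + 2)) - real (n + 2) ^ 3 * V (n + 2)"
    by (simp add: algebra_simps)
  also have "\<dots> = c * (apery_coeff (n + 1) * U (n + 1) - real (n + 1) ^ 3 * U n)
      - (apery_coeff (n + 1) * V (n + 1) - real (n + 1) ^ 3 * V n)"
    using assms unfolding apery_solution_def by metis
  also have "\<dots> = apery_coeff (n + 1) * (c * U (n + 1) - V (n + 1)) - real (n + 1) ^ 3 * (c * U n - V n)"
    by (simp only: algebra_simps)
  finally show "real (n + 2) ^ 3 * (c * U (n + 2) - V (n + 2))
      = apery_coeff (n + 1) * (c * U (n + 1) - V (n + 1)) - real (n + 1) ^ 3 * (c * U n - V n)" .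
qed

section \<open>Ball's series for the Apery remainders\<close>

text \<open>
  \<open>ball_core n t\<close> is the summand of Ball's series without the factor \<open>2t + n\<close>, given by its ratio in \<open>n\<close>.
  It vanishes at \<open>t = 1, \<dots>, n\<close>.
\<close>
primrec ball_core :: "nat \<Rightarrow> real \<Rightarrow> real" where
  "ball_core 0 t = 1 / t ^ 4"
| "ball_core (Suc m) t = ball_core m t *
     ((real m + 1)\<^sup>2 * (t - real m - 1) * (t + 2 * real m + 1) * (t + 2 * real m + 2) / (t + real m + 1) ^ 5)"

text \<open>Ball's summand is hypergeometric in t as well as in n. The factor
  \<open>t - real m\<close>, which would be a denominator of the shift ratio, stays on the left
  because it vanishes at t = m.\<close>

lemma ball_core_shift:
  assumes "t > 0"
  shows "(t - real m) * ball_core m (t + 1) = t ^ 5 * (t + 2 * real m + 1) * ball_core m t / (t + real m + 1) ^ 5"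
proof (induction m)
  case 0
  show ?case using assms by (simp add: divide_simps) algebra
next
  case (Suc m)
  define x where "x = real m"
  have "(t - real (Suc m)) * ball_core (Suc m) (t + 1)
      = ((t - x) * ball_core m (t + 1)) * ((t - x - 1) * (x + 1)\<^sup>2 * (t + 2 * x + 2) * (t + 2 * x + 3) / (t + x + 2) ^ 5)"
    by (simp add: x_def algebra_simps)
  also have "(t - x) * ball_core m (t + 1) = t ^ 5 * (t + 2 * x + 1) * ball_core m t / (t + x + 1) ^ 5"
    using Suc.IH by (simp add: x_def)
  finally show ?case
    by (simp add: x_def add_ac)
qed

lemma ball_core_eq_0:
  assumes "k < n"
  shows "ball_core n (real (Suc k)) = 0"
  using assms
proof (induction n)
  case (Suc n)
  show ?case
  proof (cases "k = n")
    case True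
    then show ?thesis by simp
  next
    case False
    with Suc have "ball_core n (real (Suc k)) = 0" by simp
    then show ?thesis by (simp only: ball_core.simps mult_zero_left)
  qed
qed simp

text \<open>At integers t > m + 1 the recursion factor lies between 0 and 1, so the bound for n = 0
  persists; at the remaining positive integers the new core vanishes.\<close>

lemma abs_ball_core_le:
  "\<bar>ball_core n (real (Suc k))\<bar> \<le> 1 / real (Suc k) ^ 4"
proof (induction n)
  case 0
  show ?case by simp
next
  case (Suc m)
  show ?case
  proof (cases "k < Suc m")
    case True
    then show ?thesis by (simp only: ball_core_eq_0) simp
  next
    case False
    define x t where "x = real m" and "t = real (Suc k)"
    have x: "0 \<le> x" "x + 1 \<le> t" using False by (auto simp: x_def t_def)
    define r where "r = (x + 1)\<^sup>2 * (t - x - 1) * (t + 2 * x + 1) * (t + 2 * x + 2)"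
    \<comment> \<open>Factor by factor: 2(x + 1) and t - x - 1 are at most t + x + 1, the last two
      factors at most 2(t + x + 1). The 4 on both sides cancels.\<close>
    have "(2 * (x + 1))\<^sup>2 * (t - x - 1) * (t + 2 * x + 1) * (t + 2 * x + 2)
        \<le> (t + x + 1)\<^sup>2 * (t + x + 1) * (2 * (t + x + 1)) * (2 * (t + x + 1))"
      using x by (intro mult_mono power_mono mult_nonneg_nonneg) auto
    moreover have "(2 * (x + 1))\<^sup>2 * (t - x - 1) * (t + 2 * x + 1) * (t + 2 * x + 2) = 4 * r"
      unfolding r_def by algebra
    moreover have "(t + x + 1)\<^sup>2 * (t + x + 1) * (2 * (t + x + 1)) * (2 * (t + x + 1)) = 4 * (t + x + 1) ^ 5"
      by algebra
    ultimately have "r \<le> (t + x + 1) ^ 5" by linarith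
    moreover have "0 \<le> r"
      unfolding r_def using x by (intro mult_nonneg_nonneg) auto
    ultimately have "\<bar>r / (t + x + 1) ^ 5\<bar> \<le> 1"
      using x by (simp add: divide_simps)
    then have "\<bar>ball_core m t\<bar> * \<bar>r / (t + x + 1) ^ 5\<bar> \<le> \<bar>ball_core m t\<bar> * 1"
      by (intro mult_left_mono) auto
    also have "\<dots> \<le> 1 / t ^ 4" using Suc.IH by (simp add: t_def)
    finally show ?thesis
      by (simp add: abs_mult r_def x_def t_def)
  qed
qed

section \<open>Bounds and first values of Ball's sums\<close>

definition ball_term :: "nat \<Rightarrow> nat \<Rightarrow> real" where
  "ball_term n k = (2 * real (Suc k) + real n) * ball_core n (real (Suc k))"

definition ball_sum :: "nat \<Rightarrow> real" where
  "ball_sum n = (\<Sum>k. ball_term n k)"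

text \<open>Only t > n contributes, and there 2t + n \<le> 3t. The bound is uniform in n, which
  makes \<open>ball_sum\<close> bounded.\<close>

lemma abs_ball_term_le: "\<bar>ball_term n k\<bar> \<le> 3 * (1 / real (Suc k) ^ 3)"
proof (cases "k < n")
  case True
  then show ?thesis by (simp only: ball_term_def ball_core_eq_0) simp
next
  case False
  define t where "t = real (Suc k)"
  have t: "real n \<le> t" "t > 0" using False by (auto simp: t_def)
  have "\<bar>2 * t + real n\<bar> * \<bar>ball_core n t\<bar> \<le> (3 * t) * (1 / t ^ 4)"
    using t abs_ball_core_le[of n k] by (intro mult_mono) (auto simp: t_def)
  also have "\<dots> = 3 * (1 / t ^ 3)"
    using t by (simp add: eval_nat_numeral)
  finally show ?thesis
    by (simp add: ball_term_def t_def abs_mult)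
qed

lemma summable_abs_ball_term: "summable (\<lambda>k. \<bar>ball_term n k\<bar>)"
proof (rule summable_comparison_test')
  show "summable (\<lambda>k. 3 * (1 / real (Suc k) ^ 3))"
    by (intro summable_mult sums_summable[OF zeta3_sums])
  show "norm \<bar>ball_term n k\<bar> \<le> 3 * (1 / real (Suc k) ^ 3)" for k
    unfolding real_norm_def abs_abs by (rule abs_ball_term_le)
qed

lemma ball_term_sums: "ball_term n sums ball_sum n"
  unfolding ball_sum_def
  by (rule summable_sums[OF summable_rabs_cancel[OF summable_abs_ball_term]])

lemma abs_ball_sum_le: "\<bar>ball_sum n\<bar> \<le> 3 * zeta3"
proof -
  have "\<bar>ball_sum n\<bar> \<le> (\<Sum>k. \<bar>ball_term n k\<bar>)"
    unfolding ball_sum_def by (rule summable_rabs[OF summable_abs_ball_term])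
  also have "\<dots> \<le> (\<Sum>k. 3 * (1 / real (Suc k) ^ 3))"
    by (rule suminf_le[OF abs_ball_term_le summable_abs_ball_term
          summable_mult[OF sums_summable[OF zeta3_sums]]])
  also have "\<dots> = 3 * zeta3"
    by (intro sums_unique[symmetric] sums_mult zeta3_sums)
  finally show ?thesis .
qed

lemma ball_sum_0: "ball_sum 0 = 2 * zeta3"
proof -
  have "ball_term 0 k = 2 * (1 / real (Suc k) ^ 3)" for k
  proof -
    define t where "t = real (Suc k)"
    have "t > 0" by (simp add: t_def)
    then have "2 * t * (1 / t ^ 4) = 2 * (1 / t ^ 3)" by (simp add: eval_nat_numeral)
    then show ?thesis by (simp add: ball_term_def t_def)
  qed
  then have "ball_term 0 = (\<lambda>k. 2 * (1 / real (Suc k) ^ 3))" by (rule ext)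
  with sums_mult[OF zeta3_sums, of 2] have "ball_term 0 sums (2 * zeta3)" by (simp only:)
  then show ?thesis using ball_term_sums sums_unique2 by blast
qed

lemma ball_sum_1: "ball_sum 1 = 10 * zeta3 - 12"
proof -
  \<comment> \<open>An antidifference of \<open>ball_term 1 - 5 * ball_term 0\<close>; its limit -1
    and the value \<open>g 1 = 11\<close> give the sum -12.\<close>
  define g :: "real \<Rightarrow> real" where "g t = (- (t ^ 4) + 5 * t ^ 2 + 5 * t + 2) / t ^ 4" for t
  have "(\<lambda>k. g (real (Suc k))) \<longlonglongrightarrow> -1"
    unfolding g_def by real_asymp
  then have "(\<lambda>k. g (real (Suc (Suc k))) - g (real (Suc k))) sums (-1 - g (real (Suc 0)))"
    by (rule telescope_sums)
  moreover have "g (real (Suc (Suc k))) - g (real (Suc k)) = ball_term 1 k - 5 * ball_term 0 k" for k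
  proof -
    define t where "t = real (Suc k)"
    have t: "t > 0" "t + 1 > 0" by (simp_all add: t_def)
    have "g (t + 1) - g t
        = (2 * t + 1) * (1 / t ^ 4 * ((t - 1) * (t + 1) * (t + 2) / (t + 1) ^ 5)) - 5 * (2 * t * (1 / t ^ 4))"
      unfolding g_def using t by (simp add: divide_simps) algebra
    then show ?thesis by (simp add: ball_term_def t_def add_ac)
  qed
  ultimately have "(\<lambda>k. ball_term 1 k - 5 * ball_term 0 k) sums (-12)"
    by (simp add: g_def)
  moreover have "(\<lambda>k. ball_term 1 k - 5 * ball_term 0 k) sums (ball_sum 1 - 5 * ball_sum 0)"
    by (intro sums_diff sums_mult ball_term_sums)
  ultimately have "ball_sum 1 - 5 * ball_sum 0 = -12" by (rule sums_unique2[symmetric])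
  then show ?thesis by (simp add: ball_sum_0)
qed

text \<open>
  The telescoping certificate is due to W. Zudilin, "An elementary proof of Apery's theorem".
\<close>
definition zudilin_poly :: "real \<Rightarrow> real \<Rightarrow> real" where
  "zudilin_poly n t =
     - (t ^ 6) - (8 * n - 1) * t ^ 5 + (4 * n ^ 2 + 27 * n + 5) * t ^ 4
     + 2 * n * (67 * n ^ 2 + 71 * n + 15) * t ^ 3
     + (358 * n ^ 4 + 339 * n ^ 3 + 76 * n ^ 2 - 7 * n - 3) * t ^ 2
     + (384 * n ^ 5 + 396 * n ^ 4 + 97 * n ^ 3 - 29 * n ^ 2 - 17 * n - 2) * t
     + n * (153 * n ^ 5 + 183 * n ^ 4 + 50 * n ^ 3 - 30 * n ^ 2 - 22 * n - 4)"

text \<open>The telescoping relation for Ball's summands of index n + 1, n, n - 1, written in u = t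
  + n and divided by the common factor n^2 \<open>ball_core (n - 1) t\<close> / (u^5 (u +
  1)^5).\<close>

lemma zudilin_poly_identity:
  fixes n u :: real
  shows "(n + 1) ^ 5 * (2 * u - n + 1) * ((u - 2 * n) * (u + n - 1) * (u + n))
           * ((u - 2 * n - 1) * (u + n + 1) * (u + n + 2))
       - (34 * n ^ 3 + 51 * n ^ 2 + 27 * n + 5) * (2 * u - n)
           * ((u - 2 * n) * (u + n - 1) * (u + n)) * (u + 1) ^ 5
       + n * (2 * u - n - 1) * u ^ 5 * (u + 1) ^ 5
     = (u - n) ^ 5 * (u + n - 1) * zudilin_poly n (u - n + 1)
       - (u - 2 * n) * zudilin_poly n (u - n) * (u + 1) ^ 5"
  unfolding zudilin_poly_def by algebra

text \<open>This is \<open>ball_core (m + 1) t * zudilin_poly (m + 1) t\<close> / ((t + 2m + 1)(t +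
  2m + 2)) with the two linear factors cancelled.\<close>

definition zudilin_cert :: "nat \<Rightarrow> real \<Rightarrow> real" where
  "zudilin_cert m t = (real m + 1)\<^sup>2 * (t - real m - 1) * zudilin_poly (real m + 1) t
     / (t + real m + 1) ^ 5 * ball_core m t"

lemma zudilin_cert_diff:
  assumes "t > 0"
  shows "zudilin_cert m (t + 1) - zudilin_cert m t =
    real (m + 2) ^ 3 * ((2 * t + real (m + 2)) * ball_core (m + 2) t)
    - apery_coeff (m + 1) * ((2 * t + real (m + 1)) * ball_core (m + 1) t)
    + real (m + 1) ^ 3 * ((2 * t + real m) * ball_core m t)"
proof -
  define n u D where "n = real m + 1" and "u = t + n" and "D = ball_core m t"
  have t: "t = u - n" by (simp add: u_def)
  have pos: "u > 0" "u + 1 > 0" using assms by (simp_all add: u_def n_def)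
  have shift: "real m + 1 = n" "t - real m - 1 = u - 2 * n" "t + 2 * real m + 1 = u + n - 1"
      "t + 2 * real m + 2 = u + n" "t + real m + 1 = u"
    and shift1: "real (Suc m) + 1 = n + 1" "t - real (Suc m) - 1 = u - 2 * n - 1"
      "t + 2 * real (Suc m) + 1 = u + n + 1" "t + 2 * real (Suc m) + 2 = u + n + 2" "t + real (Suc m) + 1 = u + 1"
    and shift2: "t + 1 - real m - 1 = t - real m" "t + 1 + real m + 1 = u + 1" "t + 1 = u - n + 1"
    by (simp_all add: u_def n_def)
  have D1: "ball_core (m + 1) t = D * (n\<^sup>2 * ((u - 2 * n) * (u + n - 1) * (u + n)) / u ^ 5)"
    unfolding D_def Suc_eq_plus1[symmetric] ball_core.simps(2)[of m] shift by (simp only: mult.assoc)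
  have D2: "ball_core (m + 2) t = ball_core (m + 1) t *
      ((n + 1)\<^sup>2 * ((u - 2 * n - 1) * (u + n + 1) * (u + n + 2)) / (u + 1) ^ 5)"
    unfolding add_2_eq_Suc' Suc_eq_plus1[symmetric] ball_core.simps(2)[of "Suc m"] shift1 by (simp only: mult.assoc)
  have C0: "zudilin_cert m t = n\<^sup>2 * (u - 2 * n) * zudilin_poly n (u - n) / u ^ 5 * D"
    unfolding zudilin_cert_def D_def shift t[symmetric] ..
  \<comment> \<open>At t + 1 the certificate supplies exactly the factor \<open>t - real m\<close>
    that \<open>ball_core_shift\<close> requires.\<close>
  have "zudilin_cert m (t + 1) = n\<^sup>2 * zudilin_poly n (t + 1) / (u + 1) ^ 5 * ((t - real m) * ball_core m (t + 1))"
    unfolding zudilin_cert_def shift(1) shift2(1,2) by (simp add: mult_ac)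
  also have "(t - real m) * ball_core m (t + 1) = (u - n) ^ 5 * (u + n - 1) * D / u ^ 5"
    unfolding ball_core_shift[OF assms] shift D_def t[symmetric] ..
  finally have C1: "zudilin_cert m (t + 1)
      = n\<^sup>2 * zudilin_poly n (u - n + 1) / (u + 1) ^ 5 * ((u - n) ^ 5 * (u + n - 1) * D / u ^ 5)"
    by (simp only: shift2(3))
  \<comment> \<open>Here and in \<open>terms\<close>, free letters stand for the polynomials, so
    extracting the common factor does not expand them.\<close>
  have cert: "n\<^sup>2 * z1 / (u + 1) ^ 5 * (p * q * D / u ^ 5) - n\<^sup>2 * r * z0 / u ^ 5 * D
      = n\<^sup>2 * D / (u ^ 5 * (u + 1) ^ 5) * (p * q * z1 - r * z0 * (u + 1) ^ 5)" for z0 z1 p q r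
    using pos by (simp add: diff_divide_distrib right_diff_distrib mult_ac)
  have terms: "n\<^sup>2 * D / (u ^ 5 * (u + 1) ^ 5)
        * (k ^ 5 * x2 * p1 * p2 - c * x1 * p1 * (u + 1) ^ 5 + n * x0 * u ^ 5 * (u + 1) ^ 5)
      = k ^ 3 * (x2 * (D * (n\<^sup>2 * p1 / u ^ 5) * (k\<^sup>2 * p2 / (u + 1) ^ 5)))
        - c * (x1 * (D * (n\<^sup>2 * p1 / u ^ 5))) + n ^ 3 * (x0 * D)" for k c x0 x1 x2 p1 p2
  proof -
    have "k ^ 5 = k ^ 3 * k\<^sup>2" "n ^ 3 = n * n\<^sup>2" by algebra+
    then show ?thesis
      using pos by (simp add: add_divide_distrib diff_divide_distrib right_diff_distrib distrib_left mult_ac)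
  qed
  have "zudilin_cert m (t + 1) - zudilin_cert m t = n\<^sup>2 * D / (u ^ 5 * (u + 1) ^ 5) *
      ((u - n) ^ 5 * (u + n - 1) * zudilin_poly n (u - n + 1)
       - (u - 2 * n) * zudilin_poly n (u - n) * (u + 1) ^ 5)"
    unfolding C0 C1 by (rule cert)
  also have "\<dots> = (n + 1) ^ 3 * ((2 * u - n + 1) * ball_core (m + 2) t)
      - (34 * n ^ 3 + 51 * n ^ 2 + 27 * n + 5) * ((2 * u - n) * ball_core (m + 1) t)
      + n ^ 3 * ((2 * u - n - 1) * D)"
    unfolding zudilin_poly_identity[symmetric] D2 D1 by (rule terms)
  finally show ?thesis
    by (simp add: D_def u_def n_def apery_coeff_def add_ac)
qed

text \<open>The lower boundary term: for m > 0 the core vanishes at t = 1, for m = 0 the factor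
  \<open>t - real m - 1\<close> does.\<close>

lemma zudilin_cert_1: "zudilin_cert m 1 = 0"
proof (cases m)
  case (Suc k)
  then have "ball_core m 1 = 0" using ball_core_eq_0[of 0 m] by simp
  then show ?thesis by (simp only: zudilin_cert_def mult_zero_right)
qed (simp add: zudilin_cert_def)

text \<open>\<open>zudilin_poly\<close> has degree 6 in t, so the rational factor grows like t^2,
  against a core of order t^(-4).\<close>

lemma zudilin_cert_tendsto_0: "(\<lambda>k. zudilin_cert m (real (Suc k))) \<longlonglongrightarrow> 0"
proof (rule Lim_null_comparison)
  define n where "n = real m"
  define f where "f t = (n + 1)\<^sup>2 * (t - n - 1) * zudilin_poly (n + 1) t / (t + n + 1) ^ 5" for t
  obtain c0 c1 c2 c3 c4 c5 where poly:
    "\<And>t. zudilin_poly (n + 1) t = - (t ^ 6) - c5 * t ^ 5 + c4 * t ^ 4 + c3 * t ^ 3 + c2 * t ^ 2 + c1 * t + c0"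
    by (rule that[OF zudilin_poly_def])
  have lim: "(\<lambda>k. (real (Suc k) - n - 1) * (- (real (Suc k) ^ 6) - c5 * real (Suc k) ^ 5 + c4 * real (Suc k) ^ 4
      + c3 * real (Suc k) ^ 3 + c2 * real (Suc k) ^ 2 + c1 * real (Suc k) + c0)
      / (real (Suc k) + n + 1) ^ 5 * (1 / real (Suc k) ^ 4)) \<longlonglongrightarrow> 0"
    by real_asymp
  show "\<forall>\<^sub>F k in sequentially. norm (zudilin_cert m (real (Suc k))) \<le> \<bar>f (real (Suc k)) * (1 / real (Suc k) ^ 4)\<bar>"
  proof (intro always_eventually allI)
    fix k
    have "norm (zudilin_cert m (real (Suc k))) = \<bar>f (real (Suc k))\<bar> * \<bar>ball_core m (real (Suc k))\<bar>"
      unfolding zudilin_cert_def f_def n_def real_norm_def by (rule abs_mult)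
    also have "\<dots> \<le> \<bar>f (real (Suc k))\<bar> * (1 / real (Suc k) ^ 4)"
      by (intro mult_left_mono abs_ball_core_le abs_ge_zero)
    also have "\<dots> = \<bar>f (real (Suc k)) * (1 / real (Suc k) ^ 4)\<bar>"
      by (simp add: abs_mult)
    finally show "norm (zudilin_cert m (real (Suc k))) \<le> \<bar>f (real (Suc k)) * (1 / real (Suc k) ^ 4)\<bar>" .
  qed
  show "(\<lambda>k. \<bar>f (real (Suc k)) * (1 / real (Suc k) ^ 4)\<bar>) \<longlonglongrightarrow> 0"
    unfolding f_def poly
    using tendsto_rabs_zero[OF tendsto_mult_right_zero[OF lim, of "(n + 1)\<^sup>2"]]
    by (simp only: mult.assoc times_divide_eq_right times_divide_eq_left)
qed

lemma apery_solution_ball_sum: "apery_solution ball_sum"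
  unfolding apery_solution_def
proof
  fix m
  let ?f = "\<lambda>k. zudilin_cert m (real (Suc (Suc k))) - zudilin_cert m (real (Suc k))"
  have "?f sums (0 - zudilin_cert m (real (Suc 0)))"
    by (rule telescope_sums[OF zudilin_cert_tendsto_0])
  then have lim: "?f sums 0" by (simp add: zudilin_cert_1)
  have f: "?f k = real (m + 2) ^ 3 * ball_term (m + 2) k
      - apery_coeff (m + 1) * ball_term (m + 1) k + real (m + 1) ^ 3 * ball_term m k" for k
    using zudilin_cert_diff[of "real (Suc k)" m]
    unfolding ball_term_def of_nat_Suc[of "Suc k"]
    by (simp only: add.commute[of 1] of_nat_0_less_iff zero_less_Suc)
  have "?f sums (real (m + 2) ^ 3 * ball_sum (m + 2) - apery_coeff (m + 1) * ball_sum (m + 1)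
      + real (m + 1) ^ 3 * ball_sum m)"
    unfolding f by (intro sums_add sums_diff sums_mult ball_term_sums)
  with lim have "0 = real (m + 2) ^ 3 * ball_sum (m + 2) - apery_coeff (m + 1) * ball_sum (m + 1)
      + real (m + 1) ^ 3 * ball_sum m"
    by (rule sums_unique2)
  then show "real (m + 2) ^ 3 * ball_sum (m + 2)
      = apery_coeff (m + 1) * ball_sum (m + 1) - real (m + 1) ^ 3 * ball_sum m" by linarith
qed

section \<open>Apery numbers\<close>

fun apery :: "nat \<Rightarrow> real" where
  "apery 0 = 1"
| "apery (Suc 0) = 5"
| "apery (Suc (Suc n)) =
     (apery_coeff (n + 1) * apery (Suc n) - real (n + 1) ^ 3 * apery n) / real (n + 2) ^ 3"

lemma apery_solution_apery: "apery_solution apery"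
  unfolding apery_solution_def by simp

text \<open>Positivity and growth need a joint induction: monotonicity absorbs the subtracted term
  x^3 \<open>apery n\<close>. Equality holds at n = 0.\<close>

lemma apery_growth: "0 < apery n \<and> 5 * apery n \<le> apery (Suc n)"
proof (induction n)
  case 0
  show ?case by simp
next
  case (Suc n)
  define x where "x = real n + 1"
  have x: "x \<ge> 1" by (simp add: x_def)
  have pos: "0 < apery (Suc n)" and le: "apery n \<le> apery (Suc n)" using Suc by auto
  have "5 * (x + 1) ^ 3 \<le> apery_coeff (n + 1) - x ^ 3"
  proof -
    have "apery_coeff (n + 1) = 34 * x ^ 3 + 51 * x ^ 2 + 27 * x + 5"
      by (simp add: apery_coeff_def x_def add_ac)
    moreover have "5 * (x + 1) ^ 3 = 5 * x ^ 3 + 15 * x ^ 2 + 15 * x + 5"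
      by algebra
    moreover have "x ^ 3 \<ge> 0" "x ^ 2 \<ge> 0" using x by auto
    ultimately show ?thesis using x by linarith
  qed
  then have "5 * (x + 1) ^ 3 * apery (Suc n) \<le> (apery_coeff (n + 1) - x ^ 3) * apery (Suc n)"
    using pos by (intro mult_right_mono) auto
  also have "\<dots> \<le> apery_coeff (n + 1) * apery (Suc n) - x ^ 3 * apery n"
    using mult_left_mono[OF le, of "x ^ 3"] x by (simp add: algebra_simps)
  also have "\<dots> = (x + 1) ^ 3 * apery (Suc (Suc n))"
    using x by (simp add: x_def add_ac)
  finally have "(x + 1) ^ 3 * (5 * apery (Suc n)) \<le> (x + 1) ^ 3 * apery (Suc (Suc n))"
    by (simp only: mult_ac)
  then have "5 * apery (Suc n) \<le> apery (Suc (Suc n))"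
    using x by (simp del: apery.simps)
  with pos show ?case by simp
qed

lemma apery_ge: "5 ^ n \<le> apery n"
proof (induction n)
  case (Suc n)
  then show ?case using apery_growth[of n] by simp
qed simp

section \<open>Continued fractions from solutions of Apery's recurrence\<close>

lemma cf_rec_eqI:
  assumes "V 0 = v" "V 1 = b 1 * v + a 1 * u"
    and "\<And>n. V (n + 2) = b (n + 2) * V (n + 1) + a (n + 2) * V n"
  shows "cf_rec b a u v n = V n"
proof (induction n rule: induct_nat_012)
  case (ge2 n)
  then show ?case using assms(3)[of n] by (simp only: cf_rec.simps(3)) simp
qed (use assms(1,2) in simp_all)

text \<open>The common argument, with s = -1 for differences and s = 1 for sums. Scaling by the
  product of the \<open>p i\<close> removes the leading coefficient in \<open>step\<close> and turns
  \<open>q n\<close> into \<open>p n * q n\<close>. The numbers in \<open>init\<close> are the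
  values of U_1 + s U_0 and U_2 + s U_1 for U = 1, 5, 73 (denominators) and U = 0, 12, 351/2
  (numerators).\<close>

lemma has_cf_value_apery:
  fixes a b p q :: "nat \<Rightarrow> real" and s :: real
  assumes s: "\<bar>s\<bar> = 1" and p: "\<And>n. p n > 0"
    and step: "\<And>U n. apery_solution U \<Longrightarrow> p (n + 1) * (U (n + 3) + s * U (n + 2))
        = b (n + 2) * (U (n + 2) + s * U (n + 1)) - q n * (U (n + 1) + s * U n)"
    and a: "\<And>n. a (n + 2) = - (p n * q n)"
    and init: "b 0 * (5 + s) = 12" "b 1 * (5 + s) = p 0 * (73 + 5 * s)"
      "(b 1 * b 0 + a 1) * (5 + s) = p 0 * (351 / 2 + 12 * s)"
  shows "has_cf_value b a (2 * zeta3)"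
proof -
  have s5: "5 + s > 0" using s by (auto simp: abs_if split: if_splits)
  \<comment> \<open>Division by 5 + s normalises the denominator at index 0 to 1.\<close>
  define c where "c n = (\<Prod>i<n. p i) / (5 + s)" for n
  have c: "c n > 0" for n unfolding c_def using p s5 by (intro divide_pos_pos prod_pos) auto
  have c_Suc: "c (n + 1) = c n * p n" for n by (simp add: c_def)
  have c0: "c 0 = 1 / (5 + s)" by (simp add: c_def)
  have c1: "c 1 = p 0 / (5 + s)" by (simp add: c_def)
  have c_step: "c (n + 2) * (U (n + 2 + 1) + s * U (n + 2))
      = b (n + 2) * (c (n + 1) * (U (n + 1 + 1) + s * U (n + 1))) + a (n + 2) * (c n * (U (n + 1) + s * U n))"
    if "apery_solution U" for U n
  proof -
    have "c (n + 2) * (U (n + 3) + s * U (n + 2)) = c (n + 1) * (p (n + 1) * (U (n + 3) + s * U (n + 2)))"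
      using c_Suc[of "n + 1"] by simp
    also have "\<dots> = b (n + 2) * (c (n + 1) * (U (n + 2) + s * U (n + 1)))
        - q n * c (n + 1) * (U (n + 1) + s * U n)"
      unfolding step[OF that] by (simp only: right_diff_distrib mult_ac)
    also have "q n * c (n + 1) = - (a (n + 2) * c n)"
      unfolding a c_Suc by simp
    finally show ?thesis by (simp add: numeral_3_eq_3)
  qed
  \<comment> \<open>Zeta values cancel at indices 0 and 1, so this is the rational companion
    solution, starting with 0, 12.\<close>
  define A where "A n = 2 * zeta3 * apery n - ball_sum n" for n
  have A: "apery_solution A"
    unfolding A_def by (rule apery_solution_mult_diff[OF apery_solution_apery apery_solution_ball_sum])
  have A0: "A 0 = 0" and A1: "A 1 = 12"
    using ball_sum_1 by (simp_all add: A_def ball_sum_0)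
  have coeff1: "apery_coeff 1 = 117" by (simp add: apery_coeff_def)
  have A2: "A (1 + 1) = 351 / 2"
    using A[unfolded apery_solution_def, rule_format, of 0] by (simp add: A0 A1[simplified] coeff1[simplified])
  have B: "apery (0 + 1) = 5" "apery (1 + 1) = 73" "apery 1 = 5"
    by (simp_all add: coeff1[simplified])
  have den_eq: "cf_den b a n = c n * (apery (n + 1) + s * apery n)" for n
    unfolding cf_den_def
  proof (rule cf_rec_eqI)
    show "c 0 * (apery (0 + 1) + s * apery 0) = 1"
      unfolding c0 B using s5 by simp
    show "c 1 * (apery (1 + 1) + s * apery 1) = b 1 * 1 + a 1 * 0"
      unfolding c1 B using s5 init(2) by (simp add: field_simps)
  qed (rule c_step[OF apery_solution_apery])
  have num_eq: "cf_num b a n = c n * (A (n + 1) + s * A n)" for n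
    unfolding cf_num_def
  proof (rule cf_rec_eqI)
    show "c 0 * (A (0 + 1) + s * A 0) = b 0"
      unfolding c0 add_0 A0 A1 using s5 init(1) by (simp add: field_simps)
    show "c 1 * (A (1 + 1) + s * A 1) = b 1 * b 0 + a 1 * 1"
      unfolding c1 A1 A2 using s5 init(3) by (simp add: field_simps)
  qed (rule c_step[OF A])
  \<comment> \<open>The worst case is s = -1: there the growth factor 5 leaves at least 4
    \<open>apery n\<close>.\<close>
  have den_ge: "apery (n + 1) + s * apery n \<ge> 4 * 5 ^ n" for n
  proof -
    have "s * apery n \<ge> - apery n"
      using s apery_growth[of n] by (cases "s = 1") (auto simp: abs_if split: if_splits)
    then show ?thesis using apery_growth[of n] apery_ge[of n] by simp
  qed
  have den_pos: "apery (n + 1) + s * apery n > 0" for n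
    by (rule less_le_trans[OF _ den_ge]) simp
  have quot: "cf_num b a n / cf_den b a n
      = 2 * zeta3 - (ball_sum (n + 1) + s * ball_sum n) / (apery (n + 1) + s * apery n)" for n
  proof -
    have "A (n + 1) + s * A n
        = 2 * zeta3 * (apery (n + 1) + s * apery n) - (ball_sum (n + 1) + s * ball_sum n)"
      unfolding A_def by (simp only: algebra_simps)
    then show ?thesis
      unfolding num_eq den_eq using c[of n] den_pos[of n] by (simp add: diff_divide_distrib)
  qed
  have "(\<lambda>n. (ball_sum (n + 1) + s * ball_sum n) / (apery (n + 1) + s * apery n)) \<longlonglongrightarrow> 0"
  proof (rule Lim_null_comparison)
    show "\<forall>\<^sub>F n in sequentially. norm ((ball_sum (n + 1) + s * ball_sum n) / (apery (n + 1) + s * apery n))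
        \<le> 6 * zeta3 / (4 * 5 ^ n)"
    proof (intro always_eventually allI)
      fix n
      have "\<bar>ball_sum (n + 1) + s * ball_sum n\<bar> \<le> \<bar>ball_sum (n + 1)\<bar> + \<bar>ball_sum n\<bar>"
        using abs_triangle_ineq[of "ball_sum (n + 1)" "s * ball_sum n"] s by (simp add: abs_mult)
      also have "\<dots> \<le> 6 * zeta3"
        using abs_ball_sum_le[of n] abs_ball_sum_le[of "n + 1"] by linarith
      finally show "norm ((ball_sum (n + 1) + s * ball_sum n) / (apery (n + 1) + s * apery n))
          \<le> 6 * zeta3 / (4 * 5 ^ n)"
        using den_ge[of n] den_pos[of n] by (simp only: real_norm_def abs_divide, intro frac_le) auto
    qed
    show "(\<lambda>n. 6 * zeta3 / (4 * 5 ^ n)) \<longlonglongrightarrow> 0"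
      by real_asymp
  qed
  from tendsto_diff[OF tendsto_const this, of "2 * zeta3"]
  have "(\<lambda>n. cf_num b a n / cf_den b a n) \<longlonglongrightarrow> 2 * zeta3"
    unfolding quot by simp
  moreover have "cf_den b a n \<noteq> 0" for n
    unfolding den_eq using c[of n] den_pos[of n] by simp
  ultimately show ?thesis
    unfolding has_cf_value_def by blast
qed

lemma apery_solution_consecutive:
  assumes "apery_solution U"
  shows "(real n + 2) ^ 3 * U (n + 2)
      = (34 * (real n + 1) ^ 3 + 51 * (real n + 1) ^ 2 + 27 * (real n + 1) + 5) * U (n + 1) - (real n + 1) ^ 3 * U n"
    and "(real n + 3) ^ 3 * U (n + 3)
      = (34 * (real n + 2) ^ 3 + 51 * (real n + 2) ^ 2 + 27 * (real n + 2) + 5) * U (n + 2)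
        - (real n + 2) ^ 3 * U (n + 1)"
proof -
  have real: "real (n + 1) = real n + 1" "real (n + 2) = real n + 2" "real (n + 1 + 1) = real n + 2"
      "real (n + 1 + 2) = real n + 3" "real (n + 3) = real n + 3"
    and shift: "n + 1 + 1 = n + 2" "n + 1 + 2 = n + 3"
    by simp_all
  show "(real n + 2) ^ 3 * U (n + 2)
      = (34 * (real n + 1) ^ 3 + 51 * (real n + 1) ^ 2 + 27 * (real n + 1) + 5) * U (n + 1) - (real n + 1) ^ 3 * U n"
    using assms[unfolded apery_solution_def, rule_format, of n] unfolding apery_coeff_def real .
  show "(real n + 3) ^ 3 * U (n + 3)
      = (34 * (real n + 2) ^ 3 + 51 * (real n + 2) ^ 2 + 27 * (real n + 2) + 5) * U (n + 2)
        - (real n + 2) ^ 3 * U (n + 1)"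
    using assms[unfolded apery_solution_def, rule_format, of "n + 1"] unfolding apery_coeff_def real shift .
qed

section \<open>The two continued fractions of the theorem\<close>

lemma has_cf_value_1: "has_cf_value b1 a1 (2 * zeta3)"
proof (rule has_cf_value_apery[where s = "-1" and p = "\<lambda>n. ((2 * real n + 1) * (real n + 2)) ^ 3"
      and q = "\<lambda>n. ((real n + 1) * (2 * real n + 5)) ^ 3"])
  fix U n assume U: "apery_solution U"
  define x u0 u1 u2 u3 where "x = real n" and "u0 = U n" and "u1 = U (n + 1)"
    and "u2 = U (n + 2)" and "u3 = U (n + 3)"
  note E = apery_solution_consecutive[OF U, of n, folded x_def u0_def u1_def u2_def u3_def]
  have p: "(2 * real (n + 1) + 1) * (real (n + 1) + 2) = (2 * x + 3) * (x + 3)"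
    by (simp add: x_def add_ac)
  have b: "b1 (n + 2) = 4 * (68 * (x + 2) ^ 6 - 45 * (x + 2) ^ 4 + 12 * (x + 2) ^ 2 - 1)"
    by (simp add: b1_def x_def add_ac)
  \<comment> \<open>On the constant sequence 1, the recurrence at index k has defect -4(2k + 1)^3.
    The multipliers (2x + 3)^3 and (2x + 5)^3 cancel these defects for k = x + 1, x + 2, so only
    differences of U remain.\<close>
  have "((2 * x + 3) * (x + 3)) ^ 3 * (u3 + -1 * u2)
      - (4 * (68 * (x + 2) ^ 6 - 45 * (x + 2) ^ 4 + 12 * (x + 2) ^ 2 - 1) * (u2 + -1 * u1)
        - ((x + 1) * (2 * x + 5)) ^ 3 * (u1 + -1 * u0))
    = (2 * x + 3) ^ 3 * ((x + 3) ^ 3 * u3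
        - ((34 * (x + 2) ^ 3 + 51 * (x + 2) ^ 2 + 27 * (x + 2) + 5) * u2 - (x + 2) ^ 3 * u1))
      - (2 * x + 5) ^ 3 * ((x + 2) ^ 3 * u2
        - ((34 * (x + 1) ^ 3 + 51 * (x + 1) ^ 2 + 27 * (x + 1) + 5) * u1 - (x + 1) ^ 3 * u0))"
    by algebra
  also have "\<dots> = 0" using E by simp
  finally show "((2 * real (n + 1) + 1) * (real (n + 1) + 2)) ^ 3 * (U (n + 3) + -1 * U (n + 2))
      = b1 (n + 2) * (U (n + 2) + -1 * U (n + 1)) - ((real n + 1) * (2 * real n + 5)) ^ 3 * (U (n + 1) + -1 * U n)"
    unfolding p b x_def[symmetric] u0_def[symmetric] u1_def[symmetric] u2_def[symmetric] u3_def[symmetric]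
    by (simp only: right_minus_eq)
next
  fix n
  have "4 * (real n + 2) ^ 2 - 4 * (real n + 2) - 3 = (2 * real n + 1) * (2 * real n + 5)" by algebra
  then show "a1 (n + 2) = - (((2 * real n + 1) * (real n + 2)) ^ 3 * ((real n + 1) * (2 * real n + 5)) ^ 3)"
    by (simp add: a1_def power_mult_distrib add_ac mult_ac)
qed (auto simp: a1_def b1_def intro!: mult_pos_pos)

lemma has_cf_value_2: "has_cf_value b2 a2 (2 * zeta3)"
proof (rule has_cf_value_apery[where s = 1
      and p = "\<lambda>n. (real n + 2) ^ 3 * (2 * real n + 1) * ((real n + 1) ^ 3 - real n ^ 3)"
      and q = "\<lambda>n. (real n + 1) ^ 3 * (2 * real n + 5) * ((real n + 3) ^ 3 - (real n + 2) ^ 3)"])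
  fix U n assume U: "apery_solution U"
  define x u0 u1 u2 u3 where "x = real n" and "u0 = U n" and "u1 = U (n + 1)"
    and "u2 = U (n + 2)" and "u3 = U (n + 3)"
  note E = apery_solution_consecutive[OF U, of n, folded x_def u0_def u1_def u2_def u3_def]
  have p: "(real (n + 1) + 2) ^ 3 * (2 * real (n + 1) + 1) * ((real (n + 1) + 1) ^ 3 - real (n + 1) ^ 3)
      = (x + 3) ^ 3 * (2 * x + 3) * ((x + 2) ^ 3 - (x + 1) ^ 3)"
    by (simp add: x_def add_ac)
  have b: "b2 (n + 2) = 2 * (102 * (x + 2) ^ 6 - 68 * (x + 2) ^ 4 + 21 * (x + 2) ^ 2 - 3)"
    by (simp add: b2_def x_def add_ac)
  \<comment> \<open>The alternating sequence must be annihilated now: up to sign its defect at index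
    k is 6(2k + 1)((k + 1)^3 - k^3), which explains the multipliers and the plus sign between the
    two recurrences.\<close>
  have "(x + 3) ^ 3 * (2 * x + 3) * ((x + 2) ^ 3 - (x + 1) ^ 3) * (u3 + 1 * u2)
      - (2 * (102 * (x + 2) ^ 6 - 68 * (x + 2) ^ 4 + 21 * (x + 2) ^ 2 - 3) * (u2 + 1 * u1)
        - (x + 1) ^ 3 * (2 * x + 5) * ((x + 3) ^ 3 - (x + 2) ^ 3) * (u1 + 1 * u0))
    = (2 * x + 3) * ((x + 2) ^ 3 - (x + 1) ^ 3) * ((x + 3) ^ 3 * u3
        - ((34 * (x + 2) ^ 3 + 51 * (x + 2) ^ 2 + 27 * (x + 2) + 5) * u2 - (x + 2) ^ 3 * u1))
      + (2 * x + 5) * ((x + 3) ^ 3 - (x + 2) ^ 3) * ((x + 2) ^ 3 * u2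
        - ((34 * (x + 1) ^ 3 + 51 * (x + 1) ^ 2 + 27 * (x + 1) + 5) * u1 - (x + 1) ^ 3 * u0))"
    by algebra
  also have "\<dots> = 0" using E by simp
  finally show "(real (n + 1) + 2) ^ 3 * (2 * real (n + 1) + 1) * ((real (n + 1) + 1) ^ 3 - real (n + 1) ^ 3)
        * (U (n + 3) + 1 * U (n + 2))
      = b2 (n + 2) * (U (n + 2) + 1 * U (n + 1))
        - (real n + 1) ^ 3 * (2 * real n + 5) * ((real n + 3) ^ 3 - (real n + 2) ^ 3) * (U (n + 1) + 1 * U n)"
    unfolding p b x_def[symmetric] u0_def[symmetric] u1_def[symmetric] u2_def[symmetric] u3_def[symmetric]
    by (simp only: right_minus_eq)
next
  fix n
  have "4 * (real n + 2) ^ 2 - 4 * (real n + 2) - 3 = (2 * real n + 1) * (2 * real n + 5)" by algebra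
  then show "a2 (n + 2) = - ((real n + 2) ^ 3 * (2 * real n + 1) * ((real n + 1) ^ 3 - real n ^ 3)
      * ((real n + 1) ^ 3 * (2 * real n + 5) * ((real n + 3) ^ 3 - (real n + 2) ^ 3)))"
    by (simp add: a2_def add_ac mult_ac)
next
  fix n
  have "(real n + 1) ^ 3 - real n ^ 3 > 0" by (simp add: power_strict_mono)
  then show "(real n + 2) ^ 3 * (2 * real n + 1) * ((real n + 1) ^ 3 - real n ^ 3) > 0"
    by (intro mult_pos_pos) auto
qed (simp_all add: a2_def b2_def)

theorem theoremA:
  shows "has_cf_value b1 a1 (2 * zeta3) \<and> has_cf_value b2 a2 (2 * zeta3)"
  using has_cf_value_1 has_cf_value_2 by (rule conjI)

end
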